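(* Let $\tilde{A}=\widehat{A}+\epsilon_2\widehat{A}_0$ be an $n\times n$ hyper-dual matrix such that the dual index of $\widehat{A}$ is 1, and let $\tilde b=\widehat b+\epsilon_2\widehat b_0\in\tilde{\mathbb{R}}^n$. If the hyper-dual group inverse $\tilde A^{\#}$ of $\tilde{A}$ exists, then $\tilde{x}=\tilde{A}^\#\tilde{b}$ is a solution of the linear hyper-dual equation $\tilde A\tilde x=\tilde b$ if and only if $$\widehat{b}=\widehat{A}\widehat{A}^{\#}\widehat{b}\quad\text{and}\quad \widehat{b}_{0}=\widehat{A}\widehat{A}^{\#}\widehat{b}_{0}+(I-\widehat{A}\widehat{A}^{\#})\widehat{A}_{0}\widehat{A}^{\#}\widehat{b}.$$
   Context: Hyper-dual numbers are elements $a_0+\epsilon_1a_1+\epsilon_2a_2+\epsilon_1\epsilon_2a_3$ with $a_i\in\mathbb{R}$, where $\epsilon_1,\epsilon_2$ commute, $\epsilon_1^2=\epsilon_2^2=0$ and $\epsilon_1\epsilon_2\ne0$ (i.e. the commutative ring $\mathbb{R}[\epsilon_1,\epsilon_2]/(\epsilon_1^2,\epsilon_2^2)$). Dual matrices (vectors) are $M_0+\epsilon_1M_1$ with $M_0,M_1$ real matrices (vectors); hyper-dual matrices (vectors) are $\widehat M+\epsilon_2\widehat M_0$ with $\widehat M,\widehat M_0$ dual matrices (vectors). $\tilde{\mathbb{R}}^n$ is the set of $n$-dimensional hyper-dual column vectors. The group inverse of a square matrix $M$ (real, dual or hyper-dual) is the (unique, if it exists) matrix $G=M^{\#}$ of the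 same type with $MGM=M$, $GMG=G$, $MG=GM$. A dual matrix $\widehat A$ has dual index 1 if the range spaces of $\widehat A^2$ and $\widehat A$ (as maps on dual vectors) coincide; this is equivalent to the existence of $\widehat A^{\#}$. *)

theory Defs
  imports "HOL-Analysis.Analysis"
begin

text \<open>
  Dual numbers over a commutative ring: \<open>Dual a b\<close> stands for \<open>a + \<epsilon> b\<close> with \<open>\<epsilon>\<^sup>2 = 0\<close>.
  The construction is polymorphic so that it can be iterated: dual numbers are \<open>real dual\<close>
  (with unit \<open>\<epsilon>\<^sub>1\<close>), and hyper-dual numbers are \<open>real dual dual\<close>, i.e.
  \<open>(a\<^sub>0 + \<epsilon>\<^sub>1 a\<^sub>1) + \<epsilon>\<^sub>2 (a\<^sub>2 + \<epsilon>\<^sub>1 a\<^sub>3)\<close>, the outer layer carrying \<open>\<epsilon>\<^sub>2\<close>.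
\<close>

datatype 'a dual = Dual (std_part: 'a) (inf_part: 'a)

instantiation dual :: (comm_ring_1) comm_ring_1
begin

definition zero_dual :: "'a dual" where
  "0 = Dual 0 0"

definition one_dual :: "'a dual" where
  "1 = Dual 1 0"

definition plus_dual :: "'a dual \<Rightarrow> 'a dual \<Rightarrow> 'a dual" where
  "x + y = Dual (std_part x + std_part y) (inf_part x + inf_part y)"

definition minus_dual :: "'a dual \<Rightarrow> 'a dual \<Rightarrow> 'a dual" where
  "x - y = Dual (std_part x - std_part y) (inf_part x - inf_part y)"

definition uminus_dual :: "'a dual \<Rightarrow> 'a dual" where
  "- x = Dual (- std_part x) (- inf_part x)"

definition times_dual :: "'a dual \<Rightarrow> 'a dual \<Rightarrow> 'a dual" where
  "x * y = Dual (std_part x * std_part y) (std_part x * inf_part y + inf_part x * std_part y)"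

instance
  by standard
    (simp_all add: zero_dual_def one_dual_def plus_dual_def minus_dual_def uminus_dual_def
      times_dual_def algebra_simps)

end

type_synonym hyperdual = "real dual dual"

definition eps1 :: hyperdual where
  "eps1 = Dual (Dual 0 1) 0"

definition eps2 :: hyperdual where
  "eps2 = Dual 0 1"

definition hyperdual_of_real :: "real \<Rightarrow> hyperdual" where
  "hyperdual_of_real a = Dual (Dual a 0) 0"

lemma hyperdual_units:
  "eps1 * eps1 = 0" "eps2 * eps2 = 0" "eps1 * eps2 \<noteq> 0"
  by (simp_all add: eps1_def eps2_def times_dual_def zero_dual_def one_dual_def)

lemma hyperdual_decomp:
  "Dual (Dual a0 a1) (Dual a2 a3) =
     hyperdual_of_real a0 + eps1 * hyperdual_of_real a1 + eps2 * hyperdual_of_real a2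
       + eps1 * eps2 * hyperdual_of_real a3"
  by (simp add: eps1_def eps2_def hyperdual_of_real_def times_dual_def plus_dual_def
      zero_dual_def one_dual_def)

text \<open>
  The hyper-dual vector \<open>v + \<epsilon>\<^sub>2 w\<close> and the hyper-dual matrix \<open>M + \<epsilon>\<^sub>2 N\<close> with dual \<open>v, w, M, N\<close>.
\<close>

definition hyperdual_vec :: "real dual ^ 'n \<Rightarrow> real dual ^ 'n \<Rightarrow> hyperdual ^ 'n" where
  "hyperdual_vec v w = (\<chi> i. Dual (v $ i) (w $ i))"

definition hyperdual_mat ::
  "real dual ^ 'n ^ 'm \<Rightarrow> real dual ^ 'n ^ 'm \<Rightarrow> hyperdual ^ 'n ^ 'm" where
  "hyperdual_mat M N = (\<chi> i j. Dual (M $ i $ j) (N $ i $ j))"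

definition is_group_inverse :: "'a::comm_ring_1 ^ 'n ^ 'n \<Rightarrow> 'a ^ 'n ^ 'n \<Rightarrow> bool" where
  "is_group_inverse M G \<longleftrightarrow> M ** G ** M = M \<and> G ** M ** G = G \<and> M ** G = G ** M"

definition has_group_inverse :: "'a::comm_ring_1 ^ 'n ^ 'n \<Rightarrow> bool" where
  "has_group_inverse M \<longleftrightarrow> (\<exists>G. is_group_inverse M G)"

definition group_inverse :: "'a::comm_ring_1 ^ 'n ^ 'n \<Rightarrow> 'a ^ 'n ^ 'n" where
  "group_inverse M = (THE G. is_group_inverse M G)"

lemma is_group_inverse_unique:
  assumes "is_group_inverse M G" and "is_group_inverse M H"
  shows "G = H"
proof -
  have G: "M ** G ** M = M" "G ** M ** G = G" "M ** G = G ** M"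
    and H: "M ** H ** M = M" "H ** M ** H = H" "M ** H = H ** M"
    using assms unfolding is_group_inverse_def by blast+
  have MG_MH: "M ** G = M ** H"
    by (metis G(1,3) H(1,3) matrix_mul_assoc)
  have "G = G ** (M ** H)"
    by (metis G(2) MG_MH matrix_mul_assoc)
  also have "\<dots> = H"
    by (metis G(3) H(2,3) MG_MH matrix_mul_assoc)
  finally show ?thesis .
qed

lemma group_inverse_eqI: "is_group_inverse M G \<Longrightarrow> group_inverse M = G"
  unfolding group_inverse_def by (blast intro: the_equality is_group_inverse_unique)

text \<open>
  Equality of ranges as maps on dual vectors; in particular invertible matrices satisfy this.
\<close>

definition dual_index_one :: "real dual ^ 'n ^ 'n \<Rightarrow> bool" where
  "dual_index_one M \<longleftrightarrow> range (\<lambda>x. (M ** M) *v x) = range (\<lambda>x. M *v x)"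

end

theory Submission
  imports Defs
begin

text \<open>
  Write \<open>At = A + \<epsilon>\<^sub>2 A0\<close> and \<open>At\<^sup># = G + \<epsilon>\<^sub>2 H\<close>. Comparing standard parts gives \<open>G = A\<^sup>#\<close>.
  Put \<open>E = A H + A0 G\<close>, the \<open>\<epsilon>\<^sub>2\<close>-part of \<open>At At\<^sup>#\<close>. Multiplying the \<open>\<epsilon>\<^sub>2\<close>-part of
  \<open>At At\<^sup># At = At\<close> by \<open>G\<close> on the right yields \<open>E A G = (I - A G) A0 G\<close>, so that on vectors
  with \<open>b = A G b\<close> the unknown \<open>H\<close> disappears from \<open>E b\<close>.
\<close>

lemma std_part_sum: "std_part (sum f S) = (\<Sum>i\<in>S. std_part (f i))"
  by (induction S rule: infinite_finite_induct) (simp_all add: zero_dual_def plus_dual_def)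

lemma inf_part_sum: "inf_part (sum f S) = (\<Sum>i\<in>S. inf_part (f i))"
  by (induction S rule: infinite_finite_induct) (simp_all add: zero_dual_def plus_dual_def)

lemma matrix_diff_rdistrib:
  fixes A B :: "'a::ring_1 ^ 'n ^ 'm"
  shows "(A - B) ** C = A ** C - B ** C"
  by (simp add: matrix_matrix_mult_def vec_eq_iff left_diff_distrib sum_subtractf)

lemma hyperdual_mat_mult:
  "hyperdual_mat M N ** hyperdual_mat P Q = hyperdual_mat (M ** P) (M ** Q + N ** P)"
  \<comment> \<open>Multiplication is unfolded only for entries over \<open>real dual\<close>: this
    splits off the eps2 layer and leaves products of dual numbers intact.\<close>
  by (simp add: hyperdual_mat_def matrix_matrix_mult_def vec_eq_iff dual.expand std_part_sum
      inf_part_sum times_dual_def[where 'a = "real dual"] sum.distrib)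

lemma hyperdual_mat_vec_mult:
  "hyperdual_mat M N *v hyperdual_vec v w = hyperdual_vec (M *v v) (M *v w + N *v v)"
  by (simp add: hyperdual_mat_def hyperdual_vec_def matrix_vector_mult_def vec_eq_iff
      dual.expand std_part_sum inf_part_sum times_dual_def[where 'a = "real dual"] sum.distrib)

lemma hyperdual_mat_eq_iff: "hyperdual_mat M N = hyperdual_mat P Q \<longleftrightarrow> M = P \<and> N = Q"
  by (auto simp: hyperdual_mat_def vec_eq_iff)

lemma hyperdual_vec_eq_iff: "hyperdual_vec v w = hyperdual_vec x y \<longleftrightarrow> v = x \<and> w = y"
  by (auto simp: hyperdual_vec_def vec_eq_iff)

lemma hyperdual_mat_cases:
  obtains M N where "X = hyperdual_mat M N"
proof
  show "X = hyperdual_mat (\<chi> i j. std_part (X $ i $ j)) (\<chi> i j. inf_part (X $ i $ j))"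
    by (simp add: hyperdual_mat_def vec_eq_iff)
qed

lemma is_group_inverse_hyperdual_matD:
  assumes "is_group_inverse (hyperdual_mat A A0) (hyperdual_mat G H)"
  shows "is_group_inverse A G"
    and "(A ** H + A0 ** G) ** (A ** G) = (mat 1 - A ** G) ** A0 ** G"
proof -
  \<comment> \<open>The product of the two hyper-dual matrices has parts \<open>A ** G\<close> and
    \<open>A ** H + A0 ** G\<close>; multiplying by the first matrix again, on the right, gives this
    eps2-part.\<close>
  have eps2_part: "A ** G ** A0 + (A ** H + A0 ** G) ** A = A0"
    and inv: "is_group_inverse A G"
    using assms
    unfolding is_group_inverse_def hyperdual_mat_mult hyperdual_mat_eq_iff by blast+
  have "(A ** H + A0 ** G) ** (A ** G) = (A0 - A ** G ** A0) ** G"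
    using eps2_part by (metis add_diff_cancel_left' matrix_mul_assoc)
  also have "A0 - A ** G ** A0 = (mat 1 - A ** G) ** A0"
    by (simp add: matrix_diff_rdistrib)
  finally show "(A ** H + A0 ** G) ** (A ** G) = (mat 1 - A ** G) ** A0 ** G" .
  show "is_group_inverse A G" by (fact inv)
qed

theorem corollary4p2:
  fixes A A0 :: "real dual ^ 'n ^ 'n"
    and b b0 :: "real dual ^ 'n"
    and At :: "hyperdual ^ 'n ^ 'n"
    and bt :: "hyperdual ^ 'n"
  assumes "At = hyperdual_mat A A0"
    and "dual_index_one A"
    and "bt = hyperdual_vec b b0"
    and "has_group_inverse At"
  shows "At *v (group_inverse At *v bt) = bt \<longleftrightarrow>
    b = (A ** group_inverse A) *v b \<and>
    b0 = (A ** group_inverse A) *v b0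
         + ((mat 1 - A ** group_inverse A) ** A0 ** group_inverse A) *v b"
proof -
  obtain Gt where Gt: "is_group_inverse At Gt"
    using assms(4) by (auto simp: has_group_inverse_def)
  obtain G H where GH: "Gt = hyperdual_mat G H"
    by (rule hyperdual_mat_cases)
  define E where "E = A ** H + A0 ** G"
  note D = is_group_inverse_hyperdual_matD[OF Gt[unfolded assms(1) GH]]
  have G: "group_inverse A = G"
    by (rule group_inverse_eqI[OF D(1)])
  have "At *v (group_inverse At *v bt) = (At ** Gt) *v bt"
    by (simp add: group_inverse_eqI[OF Gt] matrix_vector_mul_assoc)
  also have "\<dots> = hyperdual_vec ((A ** G) *v b) ((A ** G) *v b0 + E *v b)"
    by (simp add: assms(1,3) GH E_def hyperdual_mat_mult hyperdual_mat_vec_mult)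
  finally have eq: "At *v (group_inverse At *v bt) = bt \<longleftrightarrow>
      (A ** G) *v b = b \<and> (A ** G) *v b0 + E *v b = b0"
    by (simp add: assms(3) hyperdual_vec_eq_iff)
  \<comment> \<open>Replace \<open>b\<close> by \<open>(A ** G) *v b\<close> and apply
    \<open>D(2)\<close>. The condition is the first conjunct on both sides of the equivalence, so
    this rewriting serves both directions.\<close>
  have "E *v b = ((mat 1 - A ** G) ** A0 ** G) *v b" if "(A ** G) *v b = b"
    using that D(2) unfolding E_def by (metis matrix_vector_mul_assoc)
  then show ?thesis
    unfolding eq G by metis
qed

end
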